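(* Let $(n,m)\mapsto p_{n,m}$ be an injective map from the set of pairs of positive integers $(n,m)$ with $m$ odd to the set of odd primes. Let $\alpha$ be a positive irrational real number, and let $S\subset\mathbb{R}$ be the additively closed set (the set of all finite nonempty sums) generated by the following elements: (i) $\alpha$; (ii) $1/2^n$ for all $n\in\mathbb{Z}$; (iii) $p_{n,m}^{-1}\left(\alpha+\frac{m}{2^n}\right)$ for all positive integers $m,n$ with $m$ odd. Let $X=\{x^s : s\in S\}$ and let $D=\mathbb{F}_2[X]_{(X)}$. Then $D$ is semi-atomic.
   Context: $\mathbb{F}_2[X]$ is the monoid algebra over $\mathbb{F}_2$ of the additive monoid $S\cup\{0\}$: its elements are finite $\mathbb{F}_2$-linear combinations of symbols $x^s$, $s\in S\cup\{0\}$, with $x^sx^t=x^{s+t}$ and $x^0=1$. $(X)$ is the ideal generated by $X$, i.e. the maximal ideal of elements with constant term $0$, and $\mathbb{F}_2[X]_{(X)}$ is the localization at it. An integral domain $D$ is semi-atomic if there exists $\beta\in D$ such that for every nonzero non-unit $\alpha\in D$, the element $\alpha\beta$ is a (finite) product of irreducible elements of $D$. *)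

theory Defs
  imports
    Complex_Main
    "HOL-Algebra.Ring_Divisibility"
    "HOL-Computational_Algebra.Primes"
    "HOL-Computational_Algebra.Fraction_Field"
    "HOL-Library.Poly_Mapping"
    "HOL-Library.Z2"
begin

definition ring_on :: "'a::comm_ring_1 set \<Rightarrow> 'a ring" where
  "ring_on A = \<lparr>carrier = A, monoid.mult = (*), one = 1, zero = 0, add = (+)\<rparr>"

text \<open>
  A finitely supported function \<open>f\<close> stands for the sum of the terms \<open>f(s) x\<^sup>s\<close>. The library
  multiplication on these functions is convolution, so for a submonoid \<open>M\<close> of the exponents the
  functions supported in \<open>M\<close> form the monoid algebra of \<open>M\<close>.
\<close>

definition monoid_algebra ::
    "'a set \<Rightarrow> ('a::comm_monoid_add \<Rightarrow>\<^sub>0 'k::comm_ring_1) ring" where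
  "monoid_algebra M = ring_on {f. Poly_Mapping.keys f \<subseteq> M}"

definition monomial :: "'a \<Rightarrow> ('a \<Rightarrow>\<^sub>0 'k::zero_neq_one)" where
  "monomial s = Poly_Mapping.single s 1"

text \<open>
  For \<open>P\<close> a prime ideal of a domain \<open>A\<close> (a subring of an ambient domain), the localization of \<open>A\<close>
  at \<open>P\<close> is realized as a subring of the fraction field of the ambient domain. Denominators
  are nonzero because \<open>0\<close> lies in \<open>P\<close>.
\<close>

definition localization_at :: "'a::idom ring \<Rightarrow> 'a set \<Rightarrow> 'a fract ring" where
  "localization_at A P = ring_on {Fract f g | f g. f \<in> carrier A \<and> g \<in> carrier A - P}"

definition semi_atomic :: "('a, 'b) ring_scheme \<Rightarrow> bool" where
  "semi_atomic R \<longleftrightarrow> domain R \<and>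
    (\<exists>b \<in> carrier R. \<forall>a \<in> carrier R. a \<noteq> \<zero>\<^bsub>R\<^esub> \<and> a \<notin> Units R \<longrightarrow>
      (\<exists>fs. set fs \<subseteq> carrier R \<and> (\<forall>f \<in> set fs. ring_irreducible\<^bsub>R\<^esub> f) \<and>
        a \<otimes>\<^bsub>R\<^esub> b = foldr (\<otimes>\<^bsub>R\<^esub>) fs \<one>\<^bsub>R\<^esub>))"

definition nonempty_sums :: "'a::monoid_add set \<Rightarrow> 'a set" where
  "nonempty_sums G = {sum_list ss | ss. ss \<noteq> [] \<and> set ss \<subseteq> G}"

end

theory Submission
  imports Defs
begin

text \<open>
  Take \<open>\<beta> = x\<^sup>2\<^sup>\<alpha>\<close>. The \<open>n\<close>-th step of the filtration of \<open>D\<close> requires every exponent of the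
  numerator to be a sum of at least \<open>n\<close> generators: a product of \<open>n\<close> non-units lies in the \<open>n\<close>-th step, so an element
  outside some step is a unit times a product of irreducibles.

  By uniqueness of digits modulo the distinct primes \<open>p\<^sub>i\<close> and irrationality of \<open>\<alpha>\<close>, an
  exponent \<open>k\<alpha> + \<Sum> r\<^sub>i g\<^sub>i\<close> with \<open>r\<^sub>i < p\<^sub>i\<close>, where \<open>g\<^sub>i = (\<alpha> + q\<^sub>i)/p\<^sub>i\<close>, is a sum of only boundedly
  many generators. Carrying the multiples of \<open>p\<^sub>i g\<^sub>i = \<alpha> + q\<^sub>i\<close> shows that every exponent is of this
  form plus a dyadic number. Pulling the least dyadic part \<open>d\<close> out of a numerator leaves an element
  outside some step of the filtration. The remaining factor \<open>x\<^sup>2\<^sup>\<alpha>\<^sup>+\<^sup>d\<close> is a product of monomials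
  \<open>x\<^sup>\<alpha>\<close> and \<open>x\<^sup>\<alpha>\<^sup>+\<^sup>q\<close> with \<open>q\<close> dyadic but not an integer, and \<open>\<alpha> + q\<close> is \<open>p\<^sub>i\<close> times a generator; the
  factor 2 is needed because an integral \<open>d\<close> has to be split into two non-integral parts.
\<close>

section \<open>Factorization in filtered domains\<close>

text \<open>The unit factor lets units themselves qualify, through the empty list, and makes the
  property stable under products without case distinctions.\<close>

definition factorable :: "('a, 'b) ring_scheme \<Rightarrow> 'a \<Rightarrow> bool" where
  "factorable R y \<longleftrightarrow> (\<exists>u \<in> Units R. \<exists>fs. set fs \<subseteq> carrier R \<and>
     (\<forall>f \<in> set fs. ring_irreducible\<^bsub>R\<^esub> f) \<and> y = u \<otimes>\<^bsub>R\<^esub> foldr (\<otimes>\<^bsub>R\<^esub>) fs \<one>\<^bsub>R\<^esub>)"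

context domain
begin

lemma foldr_mult_closed: "set fs \<subseteq> carrier R \<Longrightarrow> foldr (\<otimes>) fs \<one> \<in> carrier R"
  by (induction fs) auto

lemma foldr_mult_append:
  assumes "set fs \<subseteq> carrier R" "set gs \<subseteq> carrier R"
  shows "foldr (\<otimes>) (fs @ gs) \<one> = foldr (\<otimes>) fs \<one> \<otimes> foldr (\<otimes>) gs \<one>"
  using assms
proof (induction fs)
  case Nil
  then show ?case by (simp add: foldr_mult_closed)
next
  case (Cons f fs)
  then have "foldr (\<otimes>) fs \<one> \<in> carrier R" "foldr (\<otimes>) gs \<one> \<in> carrier R"
    by (auto intro!: foldr_mult_closed)
  with Cons show ?case by (simp add: m_assoc)
qed

lemma factorable_unit: "u \<in> Units R \<Longrightarrow> factorable R u"
  unfolding factorable_def by (intro bexI[of _ u] exI[of _ "[]"]) auto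

lemma factorable_irreducible: "f \<in> carrier R \<Longrightarrow> ring_irreducible f \<Longrightarrow> factorable R f"
  unfolding factorable_def by (intro bexI[of _ \<one>] exI[of _ "[f]"]) auto

lemma factorable_mult:
  assumes "factorable R x" "factorable R y"
  shows "factorable R (x \<otimes> y)"
proof -
  from assms(1) obtain u fs where x: "u \<in> Units R" "set fs \<subseteq> carrier R"
    "\<forall>f \<in> set fs. ring_irreducible f" "x = u \<otimes> foldr (\<otimes>) fs \<one>"
    unfolding factorable_def by blast
  from assms(2) obtain v gs where y: "v \<in> Units R" "set gs \<subseteq> carrier R"
    "\<forall>f \<in> set gs. ring_irreducible f" "y = v \<otimes> foldr (\<otimes>) gs \<one>"
    unfolding factorable_def by blast
  have "x \<otimes> y = (u \<otimes> v) \<otimes> foldr (\<otimes>) (fs @ gs) \<one>"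
    using foldr_mult_closed[OF x(2)] foldr_mult_closed[OF y(2)] x(1) y(1)
    unfolding foldr_mult_append[OF x(2) y(2)] x(4) y(4)
    by (simp add: m_ac Units_closed)
  then show ?thesis
    unfolding factorable_def using x y
    by (intro bexI[of _ "u \<otimes> v"] exI[of _ "fs @ gs"]) auto
qed

lemma ring_irreducible_unit_mult:
  assumes "u \<in> Units R" "f \<in> carrier R" "ring_irreducible f"
  shows "ring_irreducible (u \<otimes> f)"
proof (rule ring_irreducibleI)
  note E = ring_irreducibleE[OF assms(2,3)]
  have u: "u \<in> carrier R" "inv u \<in> carrier R" using assms(1) by auto
  have "u \<noteq> \<zero>" using assms(1) Units_l_inv[of u] u one_not_zero by fastforce
  note u = u this
  show "u \<otimes> f \<in> carrier R - {\<zero>}" using u assms(2) E(1) by (auto simp: integral_iff)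
  show "u \<otimes> f \<notin> Units R"
    using assms(1,2) E(4) u by (metis Units_m_closed Units_inv_Units Units_l_inv l_one m_assoc)
  fix a b assume ab: "a \<in> carrier R" "b \<in> carrier R" "u \<otimes> f = a \<otimes> b"
  have "f = inv u \<otimes> (u \<otimes> f)"
    using u assms by (simp flip: m_assoc)
  also have "\<dots> = (inv u \<otimes> a) \<otimes> b" using ab u by (simp add: m_assoc)
  finally have "inv u \<otimes> a \<in> Units R \<or> b \<in> Units R"
    using E(5)[of "inv u \<otimes> a" b] ab u by auto
  moreover have "a = u \<otimes> (inv u \<otimes> a)" using ab u assms by (simp flip: m_assoc)
  ultimately show "a \<in> Units R \<or> b \<in> Units R"
    using assms(1) by (metis Units_m_closed)
qed

text \<open>The unit is absorbed into the first irreducible factor; the list has one, since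
  otherwise \<open>y\<close> would be a unit.\<close>

lemma factorable_nonunit_prod:
  assumes "factorable R y" "y \<notin> Units R"
  shows "\<exists>fs. set fs \<subseteq> carrier R \<and> (\<forall>f \<in> set fs. ring_irreducible f) \<and> y = foldr (\<otimes>) fs \<one>"
proof -
  from assms(1) obtain u fs where y: "u \<in> Units R" "set fs \<subseteq> carrier R"
    "\<forall>f \<in> set fs. ring_irreducible f" "y = u \<otimes> foldr (\<otimes>) fs \<one>"
    unfolding factorable_def by blast
  show ?thesis
  proof (cases fs)
    case Nil
    with y assms(2) show ?thesis by simp
  next
    case (Cons f gs)
    then show ?thesis
      using y ring_irreducible_unit_mult[of u f] foldr_mult_closed[of gs]
      by (intro exI[of _ "(u \<otimes> f) # gs"]) (auto simp: m_assoc Units_closed)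
  qed
qed

text \<open>If \<open>y\<close> is neither a unit nor irreducible, it is a product of two non-units,
  both in \<open>J 1\<close>. If one of them were in \<open>J n\<close>, then \<open>y\<close> would
  be in \<open>J (Suc n)\<close>. So both factors avoid the earlier step \<open>J n\<close>, and
  induction on \<open>n\<close> ends the splitting.\<close>

lemma factorable_filtration:
  fixes J :: "nat \<Rightarrow> 'a set"
  assumes J0: "carrier R \<subseteq> J 0"
    and J1: "carrier R - Units R \<subseteq> J 1"
    and J_mult: "\<And>a b x y. x \<in> J a \<Longrightarrow> y \<in> J b \<Longrightarrow> x \<otimes> y \<in> J (a + b)"
    and y: "y \<in> carrier R" "y \<noteq> \<zero>" "y \<notin> J n"
  shows "factorable R y"
  using y
proof (induction n arbitrary: y)
  case 0
  then show ?case using J0 by auto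
next
  case (Suc n)
  show ?case
  proof (cases "y \<in> Units R \<or> ring_irreducible y")
    case True
    then show ?thesis using Suc.prems factorable_unit factorable_irreducible by blast
  next
    case False
    then obtain a b where ab: "a \<in> carrier R" "b \<in> carrier R" "y = a \<otimes> b"
      "a \<notin> Units R" "b \<notin> Units R"
      using ring_irreducibleI[of y] Suc.prems by blast
    then have "a \<in> J 1" "b \<in> J 1" using J1 by auto
    then have "a \<notin> J n" "b \<notin> J n"
      using J_mult[of a n b 1] J_mult[of a 1 b n] ab Suc.prems by auto
    moreover have "a \<noteq> \<zero>" "b \<noteq> \<zero>" using ab Suc.prems by auto
    ultimately show ?thesis using Suc.IH ab factorable_mult by blast
  qed
qed

end

section \<open>Monoid algebras\<close>

lemma cring_ring_on:
  fixes B :: "'a::comm_ring_1 set"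
  assumes "0 \<in> B" "1 \<in> B" "\<And>x y. x \<in> B \<Longrightarrow> y \<in> B \<Longrightarrow> x + y \<in> B"
    "\<And>x. x \<in> B \<Longrightarrow> - x \<in> B" "\<And>x y. x \<in> B \<Longrightarrow> y \<in> B \<Longrightarrow> x * y \<in> B"
  shows "cring (ring_on B)"
proof (rule cringI)
  show "abelian_group (ring_on B)"
    using assms by (intro abelian_groupI) (auto simp: ring_on_def add_ac intro: bexI[of _ "- _"])
  show "comm_monoid (ring_on B)"
    using assms by (intro comm_monoidI) (auto simp: ring_on_def mult_ac)
qed (auto simp: ring_on_def distrib_right)

lemma domain_ring_on:
  fixes B :: "'a::idom set"
  assumes "0 \<in> B" "1 \<in> B" "\<And>x y. x \<in> B \<Longrightarrow> y \<in> B \<Longrightarrow> x + y \<in> B"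
    "\<And>x. x \<in> B \<Longrightarrow> - x \<in> B" "\<And>x y. x \<in> B \<Longrightarrow> y \<in> B \<Longrightarrow> x * y \<in> B"
  shows "domain (ring_on B)"
  using cring_ring_on[OF assms] by (intro domain.intro domain_axioms.intro) (auto simp: ring_on_def)

section \<open>Sums of at least \<open>n\<close> generators\<close>

definition long_sums :: "'a::monoid_add set \<Rightarrow> nat \<Rightarrow> 'a set" where
  "long_sums G n = {sum_list ss | ss. n \<le> length ss \<and> set ss \<subseteq> G}"

lemma long_sums_antimono: "m \<le> n \<Longrightarrow> long_sums G n \<subseteq> long_sums G m"
  unfolding long_sums_def by force

lemma long_sums_add:
  assumes "s \<in> long_sums G m" "t \<in> long_sums G n"
  shows "s + t \<in> long_sums G (m + n)"
proof -
  from assms obtain ss ts where "s = sum_list ss" "m \<le> length ss" "set ss \<subseteq> G"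
     "t = sum_list ts" "n \<le> length ts" "set ts \<subseteq> G"
    unfolding long_sums_def by blast
  then show ?thesis unfolding long_sums_def
    by (intro CollectI exI[of _ "ss @ ts"]) auto
qed

lemma zero_in_long_sums: "0 \<in> long_sums G 0"
  unfolding long_sums_def by (intro CollectI exI[of _ "[]"]) auto

lemma long_sums_1: "long_sums G (Suc 0) = nonempty_sums G"
proof -
  have "Suc 0 \<le> length ss \<longleftrightarrow> ss \<noteq> []" for ss :: "'a list" by (cases ss) auto
  then show ?thesis by (simp add: long_sums_def nonempty_sums_def)
qed

lemma long_sums_0: "long_sums G 0 = insert 0 (nonempty_sums G)"
proof -
  have "s \<in> long_sums G 0 \<longleftrightarrow> s = 0 \<or> s \<in> nonempty_sums G" for s
    unfolding long_sums_def nonempty_sums_def by (force intro: exI[of _ "[]"])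
  then show ?thesis by auto
qed

lemma long_sums_0_add: "s \<in> long_sums G 0 \<Longrightarrow> t \<in> long_sums G 0 \<Longrightarrow> s + t \<in> long_sums G 0"
  using long_sums_add[of s G 0 t 0] by simp

lemma generator_in_long_sums: "g \<in> G \<Longrightarrow> g \<in> long_sums G 1"
  unfolding long_sums_def by (intro CollectI exI[of _ "[g]"]) auto

text \<open>An element may be a sum of generators in several ways and lengths. As
  \<open>long_sums G n\<close> decreases with \<open>n\<close>, missing one step bounds the lengths
  of all its representations at once.\<close>

definition bounded_length :: "'a::monoid_add set \<Rightarrow> 'a set" where
  "bounded_length G = {s \<in> long_sums G 0. \<exists>n. s \<notin> long_sums G n}"

text \<open>For commutative exponents and coefficients in a commutative ring, this is the
  \<open>n\<close>-th power of the ideal generated by the monomials \<open>x\<^sup>s\<close> with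
  \<open>s\<close> in \<open>nonempty_sums G\<close>.\<close>

definition alg_filt ::
    "'a::monoid_add set \<Rightarrow> nat \<Rightarrow> ('a \<Rightarrow>\<^sub>0 'k::zero) set" where
  "alg_filt G n = {f. Poly_Mapping.keys f \<subseteq> long_sums G n}"

lemma poly_mapping_sum_single:
  "(\<Sum>s\<in>Poly_Mapping.keys f. Poly_Mapping.single s (Poly_Mapping.lookup f s)) = f"
proof (rule poly_mapping_eqI)
  fix k
  show "Poly_Mapping.lookup (\<Sum>s\<in>Poly_Mapping.keys f.
      Poly_Mapping.single s (Poly_Mapping.lookup f s)) k = Poly_Mapping.lookup f k"
    by (simp add: lookup_sum lookup_single when_def in_keys_iff)
qed

lemma alg_filt_add: "f \<in> alg_filt G n \<Longrightarrow> g \<in> alg_filt G n \<Longrightarrow> f + g \<in> alg_filt G n"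
  using keys_add[of f g] by (auto simp: alg_filt_def)

lemma alg_filt_diff:
  fixes f g :: "'a::monoid_add \<Rightarrow>\<^sub>0 'k::ab_group_add"
  shows "f \<in> alg_filt G n \<Longrightarrow> g \<in> alg_filt G n \<Longrightarrow> f - g \<in> alg_filt G n"
  using keys_diff[of f g] by (auto simp: alg_filt_def)

lemma alg_filt_uminus:
  fixes f :: "'a::monoid_add \<Rightarrow>\<^sub>0 'k::ab_group_add"
  shows "f \<in> alg_filt G n \<Longrightarrow> - f \<in> alg_filt G n"
  by (simp add: alg_filt_def keys_minus)

lemma alg_filt_mult: "f \<in> alg_filt G m \<Longrightarrow> g \<in> alg_filt G n \<Longrightarrow> f * g \<in> alg_filt G (m + n)"
  using keys_mult[of f g] long_sums_add[of _ G m _ n] by (fastforce simp: alg_filt_def)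

lemma alg_filt_0_mult: "f \<in> alg_filt G 0 \<Longrightarrow> g \<in> alg_filt G n \<Longrightarrow> f * g \<in> alg_filt G n"
  using alg_filt_mult[of f G 0 g n] by simp

lemma alg_filt_zero: "0 \<in> alg_filt G n"
  by (simp add: alg_filt_def)

lemma alg_filt_single_0: "Poly_Mapping.single 0 c \<in> alg_filt G 0"
  using zero_in_long_sums[of G] by (auto simp: alg_filt_def)

lemma alg_filt_single: "s \<in> long_sums G n \<Longrightarrow> Poly_Mapping.single s c \<in> alg_filt G n"
  by (auto simp: alg_filt_def)

lemma alg_filt_one: "(1 :: 'a::monoid_add \<Rightarrow>\<^sub>0 'k::zero_neq_one) \<in> alg_filt G 0"
  using zero_in_long_sums[of G] by (auto simp: alg_filt_def)

lemma alg_filt_antimono: "m \<le> n \<Longrightarrow> alg_filt G n \<subseteq> alg_filt G m"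
  using long_sums_antimono[of m n G] by (auto simp: alg_filt_def)

lemma carrier_monoid_algebra: "carrier (monoid_algebra (nonempty_sums G \<union> {0})) = alg_filt G 0"
  by (simp add: monoid_algebra_def ring_on_def alg_filt_def long_sums_0)

lemma cring_monoid_algebra:
  "cring (monoid_algebra (nonempty_sums G \<union> {0}) :: ('a::comm_monoid_add \<Rightarrow>\<^sub>0 'k::comm_ring_1) ring)"
proof -
  have "{f :: 'a \<Rightarrow>\<^sub>0 'k. Poly_Mapping.keys f \<subseteq> nonempty_sums G \<union> {0}} = alg_filt G 0"
    by (auto simp: alg_filt_def long_sums_0)
  then show ?thesis unfolding monoid_algebra_def
    by (auto intro!: cring_ring_on alg_filt_zero alg_filt_one alg_filt_add alg_filt_uminus
        alg_filt_0_mult)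
qed

text \<open>An element of \<open>alg_filt G 1\<close> is a finite sum of terms, each a constant
  times a monomial of the generating set; conversely \<open>alg_filt G 1\<close> is an ideal
  containing these monomials.\<close>

lemma genideal_monomials:
  fixes G :: "'a::comm_monoid_add set"
  defines "A \<equiv> monoid_algebra (nonempty_sums G \<union> {0}) :: ('a \<Rightarrow>\<^sub>0 'k::comm_ring_1) ring"
  shows "Idl\<^bsub>A\<^esub> (monomial ` nonempty_sums G) = alg_filt G 1"
proof
  interpret cring A unfolding A_def by (rule cring_monoid_algebra)
  have [simp]: "carrier A = alg_filt G 0" "mult A = (*)" "add A = (+)" "zero A = 0" "one A = 1"
    unfolding A_def using carrier_monoid_algebra[of G]
    by (simp_all add: monoid_algebra_def ring_on_def)
  have sub: "monomial ` nonempty_sums G \<subseteq> (alg_filt G 1 :: ('a \<Rightarrow>\<^sub>0 'k) set)"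
    by (auto simp: monomial_def alg_filt_def long_sums_1)
  have "alg_filt G 1 \<subseteq> (alg_filt G 0 :: ('a \<Rightarrow>\<^sub>0 'k) set)" by (rule alg_filt_antimono) simp
  note in0 = subsetD[OF this]
  have minus: "\<ominus>\<^bsub>A\<^esub> f = - f" if "f \<in> alg_filt G 0" for f
    using that by (intro minus_equality) (auto intro: alg_filt_uminus)
  have "subgroup (alg_filt G 1) (add_monoid A)"
  proof (rule subgroup.intro)
    fix f :: "'a \<Rightarrow>\<^sub>0 'k" assume "f \<in> alg_filt G 1"
    then show "inv\<^bsub>add_monoid A\<^esub> f \<in> alg_filt G 1"
      using minus[of f] in0[of f] by (simp only: a_inv_def alg_filt_uminus)
  qed (auto simp: alg_filt_zero intro: in0 alg_filt_add)
  then have "ideal (alg_filt G 1) A"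
  proof (rule idealI[OF ring_axioms])
    fix f h :: "'a \<Rightarrow>\<^sub>0 'k" assume "f \<in> alg_filt G 1" "h \<in> carrier A"
    then have "h * f \<in> alg_filt G 1" by (intro alg_filt_0_mult) simp_all
    then show "h \<otimes>\<^bsub>A\<^esub> f \<in> alg_filt G 1" "f \<otimes>\<^bsub>A\<^esub> h \<in> alg_filt G 1"
      by (simp_all add: mult.commute)
  qed
  then show "Idl\<^bsub>A\<^esub> (monomial ` nonempty_sums G) \<subseteq> alg_filt G 1"
    using sub by (rule genideal_minimal)
  have "monomial ` nonempty_sums G \<subseteq> carrier A" using sub in0 by auto
  note idl = genideal_ideal[OF this] genideal_self[OF this]
  interpret J: ideal "Idl\<^bsub>A\<^esub> (monomial ` nonempty_sums G)" A by (rule idl)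
  show "alg_filt G 1 \<subseteq> Idl\<^bsub>A\<^esub> (monomial ` nonempty_sums G)"
  proof
    fix f :: "'a \<Rightarrow>\<^sub>0 'k" assume f: "f \<in> alg_filt G 1"
    have *: "Poly_Mapping.single s c \<in> Idl\<^bsub>A\<^esub> (monomial ` nonempty_sums G)"
      if "s \<in> Poly_Mapping.keys f" for s c
    proof -
      have "s \<in> nonempty_sums G" using that f by (auto simp: alg_filt_def long_sums_1)
      then have "Poly_Mapping.single 0 c \<otimes>\<^bsub>A\<^esub> monomial s \<in> Idl\<^bsub>A\<^esub> (monomial ` nonempty_sums G)"
        using idl(2) by (intro J.I_l_closed) (auto intro: alg_filt_single_0)
      then show ?thesis by (simp add: monomial_def mult_single)
    qed
    have "(\<Sum>s\<in>K. Poly_Mapping.single s (Poly_Mapping.lookup f s))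
        \<in> Idl\<^bsub>A\<^esub> (monomial ` nonempty_sums G)"
      if "finite K" "K \<subseteq> Poly_Mapping.keys f" for K
      using that
    proof induction
      case empty
      then show ?case using J.zero_closed by simp
    next
      case (insert s K)
      then show ?case using J.a_closed[OF *[of s]] by simp
    qed
    from this[of "Poly_Mapping.keys f"] show "f \<in> Idl\<^bsub>A\<^esub> (monomial ` nonempty_sums G)"
      by (simp add: poly_mapping_sum_single)
  qed
qed

text \<open>Write \<open>g = c + h\<close> with a nonzero constant \<open>c\<close> and
  \<open>h\<close> in step 1. Then \<open>c * f = f * g - f * h\<close>, and \<open>f * h\<close>
  lies one step deeper than \<open>f\<close>; so \<open>f\<close> climbs from step 0 up to step
  \<open>n\<close>.\<close>

lemma alg_filt_cancel:
  fixes f g :: "'a::comm_monoid_add \<Rightarrow>\<^sub>0 'k::field"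
  assumes f: "f \<in> alg_filt G 0" and g: "g \<in> alg_filt G 0 - alg_filt G 1"
    and fg: "f * g \<in> alg_filt G n"
  shows "f \<in> alg_filt G n"
proof -
  define c where "c = Poly_Mapping.lookup g 0"
  define h where "h = g - Poly_Mapping.single 0 c"
  have "0 \<in> Poly_Mapping.keys g" and "Poly_Mapping.keys g \<subseteq> insert 0 (long_sums G 1)"
    using g by (auto simp: alg_filt_def long_sums_1 long_sums_0)
  then have "c \<noteq> 0" and h: "h \<in> alg_filt G 1"
    by (auto simp: alg_filt_def c_def h_def in_keys_iff lookup_minus lookup_single when_def
        split: if_splits)
  have "f \<in> alg_filt G j" if "j \<le> n" for j
    using that
  proof (induction j)
    case 0
    show ?case by (rule f)
  next
    case (Suc j)
    have "f * g - f * h \<in> alg_filt G (Suc j)"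
      using Suc fg alg_filt_mult[of f G j h 1] h alg_filt_antimono[of "Suc j" n G]
      by (intro alg_filt_diff) auto
    then have "Poly_Mapping.single 0 (inverse c) * (f * g - f * h) \<in> alg_filt G (Suc j)"
      by (intro alg_filt_0_mult alg_filt_single_0)
    also have "f * g - f * h = Poly_Mapping.single 0 c * f"
      by (simp add: h_def algebra_simps)
    also have "Poly_Mapping.single 0 (inverse c) * (Poly_Mapping.single 0 c * f) = f"
      using \<open>c \<noteq> 0\<close> by (simp add: mult_single flip: mult.assoc)
    finally show ?case .
  qed
  then show ?thesis by simp
qed

section \<open>The localized monoid algebra\<close>

text \<open>The parameter \<open>kt\<close> only makes the coefficient field part of the locale.\<close>
locale positive_generators =
  fixes G :: "'a::linordered_ab_group_add set" and kt :: "'k::field itself"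
  assumes pos: "g \<in> G \<Longrightarrow> 0 < g"
begin

lemma zero_notin_nonempty_sums: "0 \<notin> nonempty_sums G"
proof -
  have "0 < sum_list ss" if "ss \<noteq> []" "set ss \<subseteq> G" for ss
    using that
  proof (induction ss rule: list_nonempty_induct)
    case (single x)
    then show ?case by (simp add: pos)
  next
    case (cons x xs)
    then show ?case by (simp add: pos add_pos_pos)
  qed
  then show ?thesis unfolding nonempty_sums_def by force
qed

text \<open>Since \<open>0\<close> is not a nonempty sum of positive generators, these are the
  elements of the algebra with nonzero constant term.\<close>

definition denoms :: "('a \<Rightarrow>\<^sub>0 'k) set" where
  "denoms = alg_filt G 0 - alg_filt G 1"

definition loc_filt :: "nat \<Rightarrow> ('a \<Rightarrow>\<^sub>0 'k) fract set" where
  "loc_filt n = {Fract f g | f g. f \<in> alg_filt G n \<and> g \<in> denoms}"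

abbreviation R :: "('a \<Rightarrow>\<^sub>0 'k) fract ring" where
  "R \<equiv> ring_on (loc_filt 0)"

lemma localization_eq:
  fixes A :: "('a \<Rightarrow>\<^sub>0 'k) ring"
  defines "A \<equiv> monoid_algebra (nonempty_sums G \<union> {0})"
  shows "localization_at A (Idl\<^bsub>A\<^esub> (monomial ` nonempty_sums G)) = R"
  unfolding localization_at_def A_def genideal_monomials carrier_monoid_algebra loc_filt_def denoms_def ..

lemma R_simps [simp]:
  "carrier R = loc_filt 0" "mult R = (*)" "one R = 1" "zero R = 0"
  by (simp_all add: ring_on_def)

text \<open>Primality of the ideal, obtained by cancellation: if \<open>f * g\<close> is in step 1
  and \<open>g\<close> is not, then \<open>f\<close> is.\<close>

lemma denoms_mult: "f \<in> denoms \<Longrightarrow> g \<in> denoms \<Longrightarrow> f * g \<in> denoms"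
  using alg_filt_cancel[of f G g 1] alg_filt_0_mult[of f G g 0] by (auto simp: denoms_def)

lemma denoms_one: "1 \<in> denoms"
  using zero_notin_nonempty_sums alg_filt_one[of G]
  by (auto simp: denoms_def alg_filt_def long_sums_1)

lemma denoms_nonzero: "g \<in> denoms \<Longrightarrow> g \<noteq> 0"
  by (auto simp: denoms_def alg_filt_zero)

lemma loc_filt_mult: "x \<in> loc_filt m \<Longrightarrow> y \<in> loc_filt n \<Longrightarrow> x * y \<in> loc_filt (m + n)"
  unfolding loc_filt_def using alg_filt_mult denoms_mult by fastforce

lemma loc_filt_add:
  assumes "x \<in> loc_filt 0" "y \<in> loc_filt 0"
  shows "x + y \<in> loc_filt 0"
proof -
  from assms obtain f g f' g' where "x = Fract f g" "f \<in> alg_filt G 0" "g \<in> denoms"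
    "y = Fract f' g'" "f' \<in> alg_filt G 0" "g' \<in> denoms"
    unfolding loc_filt_def by blast
  moreover from this have "f * g' + f' * g \<in> alg_filt G 0"
    by (auto simp: denoms_def intro!: alg_filt_add alg_filt_0_mult)
  ultimately show ?thesis
    unfolding loc_filt_def using denoms_nonzero denoms_mult by fastforce
qed

lemma Fract_in_loc_filt: "f \<in> alg_filt G n \<Longrightarrow> g \<in> denoms \<Longrightarrow> Fract f g \<in> loc_filt n"
  unfolding loc_filt_def by blast

lemma domain_R: "domain R"
proof (rule domain_ring_on)
  show "0 \<in> loc_filt 0" "1 \<in> loc_filt 0"
    unfolding Zero_fract_def One_fract_def
    by (auto intro!: Fract_in_loc_filt alg_filt_zero alg_filt_one denoms_one)
  show "- x \<in> loc_filt 0" if "x \<in> loc_filt 0" for x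
  proof -
    from that obtain f g where "x = Fract f g" "f \<in> alg_filt G 0" "g \<in> denoms"
      unfolding loc_filt_def by blast
    then show ?thesis by (auto intro: Fract_in_loc_filt alg_filt_uminus)
  qed
qed (use loc_filt_add loc_filt_mult[of _ 0 _ 0] in auto)

text \<open>Membership in \<open>loc_filt n\<close> only asks for some suitable fraction.
  Cross-multiplying and cancelling the other denominator shows that every admissible numerator
  detects it.\<close>

lemma numerator_in_alg_filt:
  assumes "Fract f g \<in> loc_filt n" "f \<in> alg_filt G 0" "g \<in> denoms"
  shows "f \<in> alg_filt G n"
proof -
  from assms(1) obtain h k where hk: "Fract f g = Fract h k" "h \<in> alg_filt G n" "k \<in> denoms"
    unfolding loc_filt_def by blast
  then have "f * k = h * g" using assms(3) denoms_nonzero by (simp add: eq_fract)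
  then have "f * k \<in> alg_filt G n"
    using hk(2) assms(3) alg_filt_0_mult[of g G h n] by (simp add: denoms_def mult.commute)
  then show ?thesis using alg_filt_cancel assms(2) hk(3) by (auto simp: denoms_def)
qed

lemma Fract_in_Units: "f \<in> denoms \<Longrightarrow> g \<in> denoms \<Longrightarrow> Fract f g \<in> Units R"
  unfolding Units_def
  by (auto simp: Fract_in_loc_filt denoms_def One_fract_def eq_fract denoms_nonzero[unfolded denoms_def]
      intro!: Fract_in_loc_filt bexI[of _ "Fract g f"])

lemma nonunits_subset: "carrier R - Units R \<subseteq> loc_filt 1"
proof
  fix x assume x: "x \<in> carrier R - Units R"
  then have "x \<in> loc_filt 0" by simp
  then obtain f g where fg: "x = Fract f g" "f \<in> alg_filt G 0" "g \<in> denoms"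
    unfolding loc_filt_def by blast
  with x have "f \<notin> denoms" using Fract_in_Units by blast
  with fg show "x \<in> loc_filt 1" by (auto simp: denoms_def intro: Fract_in_loc_filt)
qed

lemma factorable_Fract:
  assumes "f \<in> alg_filt G 0" "f \<notin> alg_filt G n" "g \<in> denoms"
  shows "factorable R (Fract f g)"
proof -
  interpret domain R by (rule domain_R)
  have "f \<noteq> 0" using assms(2) alg_filt_zero by auto
  then have "Fract f g \<noteq> 0"
    using assms(3) denoms_nonzero by (auto simp: Zero_fract_def eq_fract)
  moreover have "Fract f g \<notin> loc_filt n" using numerator_in_alg_filt assms by blast
  ultimately show ?thesis
    using factorable_filtration[of loc_filt "Fract f g" n] nonunits_subset loc_filt_mult assms
    by (auto intro: Fract_in_loc_filt)
qed

lemma factorable_monomial_sum: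
  assumes "set ss \<subseteq> bounded_length G"
  shows "factorable R (Fract (Poly_Mapping.single (sum_list ss) 1) 1)"
  using assms
proof (induction ss)
  case Nil
  then show ?case
    using domain.factorable_unit[OF domain_R Fract_in_Units[OF denoms_one denoms_one]] by simp
next
  case (Cons s ss)
  then obtain n where "s \<in> long_sums G 0" "s \<notin> long_sums G n"
    by (auto simp: bounded_length_def)
  then have "factorable R (Fract (Poly_Mapping.single s 1) 1)"
    by (intro factorable_Fract[of _ n]) (auto simp: alg_filt_def denoms_one)
  from domain.factorable_mult[OF domain_R this Cons.IH] Cons.prems show ?case
    by (simp add: mult_single)
qed

text \<open>This separates the algebra from the arithmetic of the exponents: \<open>E\<close> will
  be the set of nonnegative dyadic numbers and \<open>b\<close> will be
  \<open>2 * \<alpha>\<close>.\<close>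

lemma semi_atomic_R:
  fixes E :: "'a set"
  assumes E_diff: "\<And>d e. d \<in> E \<Longrightarrow> e \<in> E \<Longrightarrow> d \<le> e \<Longrightarrow> e - d \<in> E"
    and E_sub: "E \<subseteq> long_sums G 0"
    and split: "\<And>s. s \<in> long_sums G 0 \<Longrightarrow> \<exists>d\<in>E. s - d \<in> bounded_length G"
    and b: "b \<in> long_sums G 0"
    and b_add: "\<And>d. d \<in> E \<Longrightarrow> \<exists>ss. set ss \<subseteq> bounded_length G \<and> b + d = sum_list ss"
  shows "semi_atomic R"
proof -
  interpret domain R by (rule domain_R)
  let ?x = "\<lambda>s. Poly_Mapping.single s (1 :: 'k)"
  have b_carrier: "Fract (?x b) 1 \<in> carrier R"
    using b by (auto simp: alg_filt_single denoms_one intro!: Fract_in_loc_filt)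
  moreover have "\<exists>fs. set fs \<subseteq> carrier R \<and> (\<forall>f\<in>set fs. ring_irreducible\<^bsub>R\<^esub> f) \<and>
      a \<otimes>\<^bsub>R\<^esub> Fract (?x b) 1 = foldr (\<otimes>\<^bsub>R\<^esub>) fs \<one>\<^bsub>R\<^esub>"
    if a: "a \<in> carrier R" "a \<noteq> \<zero>\<^bsub>R\<^esub>" "a \<notin> Units R" for a
  proof -
    from a have "a \<in> loc_filt 0" by simp
    then obtain f g where fg: "a = Fract f g" "f \<in> alg_filt G 0" "g \<in> denoms"
      unfolding loc_filt_def by blast
    with a have "f \<noteq> 0" by (auto simp: Zero_fract_def eq_fract)
    let ?K = "Poly_Mapping.keys f"
    have "\<forall>s\<in>?K. \<exists>d\<in>E. s - d \<in> bounded_length G"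
      using split fg(2) by (auto simp: alg_filt_def)
    then obtain e where e: "\<And>s. s \<in> ?K \<Longrightarrow> e s \<in> E"
      "\<And>s. s \<in> ?K \<Longrightarrow> s - e s \<in> bounded_length G"
      by metis
    \<comment> \<open>With the least \<open>e s\<close>, every \<open>e s - d\<close> stays in
      \<open>E\<close>, so all shifted exponents remain in the monoid; the exponent
      \<open>s0\<close> attaining it becomes one of bounded length.\<close>
    define d where "d = Min (e ` ?K)"
    have "d \<in> e ` ?K" unfolding d_def using \<open>f \<noteq> 0\<close> by (intro Min_in) auto
    then obtain s0 where s0: "s0 \<in> ?K" "d = e s0" by auto
    have d_le: "d \<le> e s" if "s \<in> ?K" for s unfolding d_def using that by auto
    \<comment> \<open>The exponent \<open>- d\<close> need not lie in the monoid, so the product is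
      formed in the ambient algebra over the whole group; that \<open>f'\<close> belongs to the
      monoid algebra is proved afterwards.\<close>
    define f' where "f' = ?x (- d) * f"
    have f: "f = ?x d * f'" by (simp add: f'_def mult_single flip: mult.assoc)
    have "Poly_Mapping.keys f' \<subseteq> (\<lambda>s. s - d) ` ?K"
      using keys_mult[of "?x (- d)" f] unfolding f'_def by fastforce
    moreover have "s - d \<in> long_sums G 0" if "s \<in> ?K" for s
    proof -
      have "(s - e s) + (e s - d) \<in> long_sums G 0"
        using that e s0 E_diff[OF _ _ d_le[OF that]] E_sub
        by (intro long_sums_0_add) (auto simp: bounded_length_def)
      then show ?thesis by simp
    qed
    ultimately have f'_in: "f' \<in> alg_filt G 0" by (auto simp: alg_filt_def)
    obtain n where n: "s0 - d \<notin> long_sums G n" using e(2)[OF s0(1)] s0(2)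
      by (auto simp: bounded_length_def)
    have "s0 - d \<in> Poly_Mapping.keys f'"
    proof -
      have "?K \<subseteq> (\<lambda>t. t + d) ` Poly_Mapping.keys f'"
        using keys_mult[of "?x d" f'] unfolding f by (fastforce simp: add.commute)
      with s0(1) show ?thesis by auto
    qed
    with n have "f' \<notin> alg_filt G n" by (auto simp: alg_filt_def)
    then have "factorable R (Fract f' g)" using factorable_Fract f'_in fg(3) by blast
    moreover have "factorable R (Fract (?x (b + d)) 1)"
      using b_add[of d] s0 e(1) factorable_monomial_sum by metis
    ultimately have "factorable R (Fract f' g * Fract (?x (b + d)) 1)"
      using factorable_mult by fastforce
    \<comment> \<open>The monomial with exponent \<open>d\<close> is moved from the numerator of
      \<open>a\<close> to the multiplier.\<close>
    also have "Fract f' g * Fract (?x (b + d)) 1 = a \<otimes>\<^bsub>R\<^esub> Fract (?x b) 1"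
      by (simp add: fg(1) f mult_single ac_simps flip: mult.assoc)
    finally have "factorable R (a \<otimes>\<^bsub>R\<^esub> Fract (?x b) 1)" .
    \<comment> \<open>Being a non-unit, the product needs no separate unit factor.\<close>
    moreover have "a \<otimes>\<^bsub>R\<^esub> Fract (?x b) 1 \<notin> Units R"
      using a b_carrier by (metis (no_types) unit_factor)
    ultimately show ?thesis using factorable_nonunit_prod by blast
  qed
  ultimately show ?thesis
    unfolding semi_atomic_def using domain_R by blast
qed

end

section \<open>Dyadic numbers and exponents\<close>

text \<open>Clearing denominators by the product \<open>Q\<close> of all the primes leaves
  \<open>z j * P j\<close> divisible by \<open>p j\<close>, because \<open>p j\<close> divides
  \<open>Q\<close> and every other \<open>P i\<close>. The cofactor \<open>P j\<close> is coprime to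
  \<open>p j\<close>.\<close>

lemma prime_dvd_numerator:
  fixes p :: "'i \<Rightarrow> nat" and z :: "'i \<Rightarrow> int"
  assumes fin: "finite F" and inj: "inj_on p F" and prime: "\<And>i. i \<in> F \<Longrightarrow> Factorial_Ring.prime (p i)"
    and int: "(\<Sum>i\<in>F. real_of_int (z i) / real (p i)) = real_of_int w" and j: "j \<in> F"
  shows "int (p j) dvd z j"
proof -
  define P where "P i = (\<Prod>l\<in>F - {i}. int (p l))" for i
  define Q where "Q = (\<Prod>l\<in>F. int (p l))"
  have Q: "Q = int (p i) * P i" if "i \<in> F" for i
    unfolding Q_def P_def using fin that by (rule prod.remove)
  have p0: "p i \<noteq> 0" if "i \<in> F" for i using prime[OF that] by auto
  have "real_of_int (Q * w) = (\<Sum>i\<in>F. real_of_int (z i * P i))"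
    unfolding of_int_mult int[symmetric] sum_distrib_left
  proof (rule sum.cong)
    fix i assume "i \<in> F"
    then show "real_of_int Q * (real_of_int (z i) / real (p i)) = real_of_int (z i) * real_of_int (P i)"
      using p0[of i] by (simp add: Q)
  qed simp
  then have "Q * w = (\<Sum>i\<in>F. z i * P i)"
    by (simp only: of_int_eq_iff flip: of_int_sum)
  also have "\<dots> = z j * P j + (\<Sum>i\<in>F - {j}. z i * P i)"
    using fin j by (rule sum.remove)
  finally have "z j * P j = Q * w - (\<Sum>i\<in>F - {j}. z i * P i)" by simp
  moreover have "int (p j) dvd P i" if "i \<in> F - {j}" for i
    unfolding P_def using that fin j by (intro dvd_prodI) auto
  then have "int (p j) dvd (\<Sum>i\<in>F - {j}. z i * P i)" by (intro dvd_sum dvd_mult) auto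
  ultimately have "int (p j) dvd z j * P j" using Q[OF j] by simp
  moreover have "coprime (int (p j)) (P j)" unfolding P_def
  proof (rule prod_coprime_right)
    fix l assume "l \<in> F - {j}"
    then show "coprime (int (p j)) (int (p l))"
      using inj j prime by (auto simp: inj_on_def coprime_int_iff intro!: primes_coprime)
  qed
  ultimately show ?thesis by (simp add: coprime_dvd_mult_left_iff)
qed

text \<open>Linear independence of \<open>1\<close> and an irrational number over the
  rationals.\<close>

lemma irrational_coeff:
  fixes a b c d x :: real
  assumes "a * x + b = c * x + d" "a \<in> \<rat>" "b \<in> \<rat>" "c \<in> \<rat>" "d \<in> \<rat>" "x \<notin> \<rat>"
  shows "a = c" "b = d"
proof -
  show "a = c"
  proof (rule ccontr)
    assume "a \<noteq> c"
    then have "x = (d - b) / (a - c)" using assms(1) by (simp add: field_simps)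
    then show False using assms by auto
  qed
  then show "b = d" using assms(1) by simp
qed

section \<open>Nonnegative dyadic numbers\<close>

definition dyadics :: "real set" where
  "dyadics = {d. 0 \<le> d \<and> (\<exists>(a::int) (n::nat). d = of_int a / 2 ^ n)}"

lemma dyadicsI: "0 \<le> of_int a / (2::real) ^ n \<Longrightarrow> of_int a / 2 ^ n \<in> dyadics"
  unfolding dyadics_def by blast

lemma dyadics_lincomb:
  assumes "d \<in> dyadics" "e \<in> dyadics" "0 \<le> of_int u * d + of_int v * e"
  shows "of_int u * d + of_int v * e \<in> dyadics"
proof -
  obtain a m b n where "d = of_int a / 2 ^ m" "e = of_int b / 2 ^ n"
    using assms(1,2) unfolding dyadics_def by blast
  then have "of_int u * d + of_int v * e = of_int (u * a * 2 ^ n + v * b * 2 ^ m) / 2 ^ (m + n)"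
    by (simp add: add_divide_distrib power_add)
  then show ?thesis using assms(3) dyadicsI by metis
qed

lemma dyadics_nonneg: "d \<in> dyadics \<Longrightarrow> 0 \<le> d"
  by (simp add: dyadics_def)

lemma dyadics_add: "d \<in> dyadics \<Longrightarrow> e \<in> dyadics \<Longrightarrow> d + e \<in> dyadics"
  using dyadics_lincomb[of d e 1 1] dyadics_nonneg[of d] dyadics_nonneg[of e] by simp

lemma dyadics_diff: "d \<in> dyadics \<Longrightarrow> e \<in> dyadics \<Longrightarrow> d \<le> e \<Longrightarrow> e - d \<in> dyadics"
  using dyadics_lincomb[of e d 1 "- 1"] by simp

lemma dyadics_nat_mult: "d \<in> dyadics \<Longrightarrow> real n * d \<in> dyadics"
  using dyadics_lincomb[of d d "int n" 0] dyadics_nonneg[of d] by simp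

lemma zero_in_dyadics: "0 \<in> dyadics"
  using dyadicsI[of 0 0] by simp

lemma dyadics_sum: "(\<And>i. i \<in> F \<Longrightarrow> f i \<in> dyadics) \<Longrightarrow> sum f F \<in> dyadics"
  by (induction F rule: infinite_finite_induct) (auto intro: zero_in_dyadics dyadics_add)

lemma dyadics_rational: "d \<in> dyadics \<Longrightarrow> d \<in> \<rat>"
  unfolding dyadics_def by auto

lemma two_powi_in_dyadics: "1 / 2 powi n \<in> dyadics"
proof (cases "0 \<le> n")
  case True
  then show ?thesis using dyadicsI[of 1 "nat n"] by (simp add: power_int_def)
next
  case False
  then show ?thesis using dyadicsI[of "2 ^ nat (- n)" 0] by (simp add: power_int_def field_simps)
qed

text \<open>Take the least exponent \<open>n\<close> of a denominator: an even numerator would allow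
  a smaller one, and \<open>n = 0\<close> would make \<open>d\<close> an integer.\<close>

lemma nonint_dyadic:
  assumes "d \<in> dyadics" "d \<notin> \<int>"
  shows "\<exists>n m. 0 < n \<and> 0 < m \<and> odd m \<and> d = real m / 2 ^ n"
proof -
  from assms(1) obtain a n where an: "0 \<le> d" "d = of_int a / 2 ^ n"
    unfolding dyadics_def by blast
  then have "0 \<le> a" by (simp add: pos_le_divide_eq)
  with an have "\<exists>n a. d = real a / 2 ^ n" by (metis nonneg_int_cases of_int_of_nat_eq)
  then have "\<exists>a. d = real a / 2 ^ (LEAST n. \<exists>a. d = real a / 2 ^ n)" by (rule LeastI_ex)
  then obtain n a where n: "n = (LEAST n. \<exists>a. d = real a / 2 ^ n)" and a: "d = real a / 2 ^ n"
    by blast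
  have "0 < n" using a assms(2) by (cases n) auto
  moreover have "odd a"
  proof
    assume "even a"
    then obtain b where "a = 2 * b" by (rule evenE)
    then have "d = real b / 2 ^ (n - 1)" using a \<open>0 < n\<close> by (cases n) auto
    then have "n \<le> n - 1" unfolding n by (intro Least_le) blast
    with \<open>0 < n\<close> show False by simp
  qed
  ultimately show ?thesis using a by (intro exI[of _ n] exI[of _ a]) (auto intro: odd_pos)
qed

text \<open>A positive integer is not of the form \<open>m / 2 ^ n\<close> with \<open>m\<close> odd
  and \<open>n\<close> positive, but \<open>1 / 2\<close> and \<open>d - 1 / 2\<close> are both
  non-integral.\<close>

lemma dyadic_split:
  assumes "d \<in> dyadics"
  obtains d1 d2 where "d = d1 + d2" "d1 \<in> dyadics" "d2 \<in> dyadics"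
    "d1 = 0 \<or> d1 \<notin> \<int>" "d2 = 0 \<or> d2 \<notin> \<int>"
proof (cases "d = 0 \<or> d \<notin> \<int>")
  case True
  then show ?thesis using that[of d 0] assms zero_in_dyadics by auto
next
  case False
  have half: "1 / 2 \<in> dyadics" using dyadicsI[of 1 1] by simp
  from False obtain k where k: "d = of_int k" by (auto elim: Ints_cases)
  with False dyadics_nonneg[OF assms] have "1 \<le> d" by simp
  have half_nonint: "(1 / 2 :: real) \<notin> \<int>"
    using fraction_not_in_Ints[of 2 1, where 'a = real] by simp
  have "d - 1 / 2 \<notin> \<int>"
  proof
    assume "d - 1 / 2 \<in> \<int>"
    then have "d - (d - 1 / 2) \<in> \<int>" using False by (intro Ints_diff) auto
    with half_nonint show False by simp
  qed
  moreover have "d - 1 / 2 \<in> dyadics" using half assms \<open>1 \<le> d\<close> by (intro dyadics_diff) auto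
  ultimately show ?thesis using that[of "1 / 2" "d - 1 / 2"] half half_nonint by auto
qed

text \<open>Counts one more occurrence of \<open>i\<close>. The value 0 outside \<open>F\<close>
  treats a new index and a repeated one alike.\<close>

lemma sum_insert_Suc:
  fixes w :: "'i \<Rightarrow> 'b::comm_semiring_1"
  assumes "finite F" "\<And>x. x \<notin> F \<Longrightarrow> c x = 0"
  shows "(\<Sum>x\<in>insert i F. of_nat ((c(i := Suc (c i))) x) * w x) = w i + (\<Sum>x\<in>F. of_nat (c x) * w x)"
proof -
  have "(\<Sum>x\<in>F. of_nat (c x) * w x) = (\<Sum>x\<in>insert i F. of_nat (c x) * w x)"
    using assms by (intro sum.mono_neutral_left) auto
  also have "\<dots> = of_nat (c i) * w i + (\<Sum>x\<in>F - {i}. of_nat (c x) * w x)"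
    using assms by (subst sum.insert_remove) auto
  finally show ?thesis
    using assms by (subst sum.insert_remove) (auto simp: algebra_simps)
qed

lemma long_sums_nat_mult:
  fixes s :: real
  assumes "s \<in> long_sums G 0"
  shows "real n * s \<in> long_sums G 0"
  by (induction n) (auto simp: algebra_simps intro: zero_in_long_sums long_sums_0_add assms)

lemma long_sums_sum:
  assumes "\<And>i. i \<in> F \<Longrightarrow> f i \<in> long_sums G 0"
  shows "sum f F \<in> long_sums G 0"
  using assms
  by (induction F rule: infinite_finite_induct) (auto intro: zero_in_long_sums long_sums_0_add)

section \<open>The exponent monoid, with \<open>q i\<close> in the role of
  \<open>m / 2 ^ n\<close>\<close>

locale dyadic_generators =
  fixes p :: "'i \<Rightarrow> nat" and q :: "'i \<Rightarrow> real" and I :: "'i set" and \<alpha> :: real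
  assumes p_inj: "inj_on p I" and p_prime: "i \<in> I \<Longrightarrow> Factorial_Ring.prime (p i)"
    and \<alpha>_pos: "0 < \<alpha>" and \<alpha>_irrational: "\<alpha> \<notin> \<rat>"
    and q_dyadic: "i \<in> I \<Longrightarrow> q i \<in> dyadics" and q_pos: "i \<in> I \<Longrightarrow> 0 < q i"
    and q_surj: "d \<in> dyadics \<Longrightarrow> d \<notin> \<int> \<Longrightarrow> \<exists>i\<in>I. d = q i"
begin

definition gen :: "'i \<Rightarrow> real" where
  "gen i = inverse (real (p i)) * (\<alpha> + q i)"

definition G :: "real set" where
  "G = {\<alpha>} \<union> {1 / 2 powi n | n :: int. True} \<union> gen ` I"

lemma p_pos: "i \<in> I \<Longrightarrow> 0 < real (p i)"
  using p_prime prime_gt_0_nat by auto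

lemma gen_pos: "i \<in> I \<Longrightarrow> 0 < gen i"
  using p_pos q_pos \<alpha>_pos by (simp add: gen_def add_pos_pos)

lemma gen_mult: "i \<in> I \<Longrightarrow> real (p i) * gen i = \<alpha> + q i"
  using p_pos[of i] by (simp add: gen_def)

text \<open>Equal generators are counted and the dyadic ones are merged into \<open>d\<close>. Their
  number is lost in the merging, but they are positive, so \<open>d = 0\<close> means that none
  occurred and then \<open>k\<close> and \<open>c\<close> account for every summand.\<close>

lemma long_sums_rep:
  assumes "s \<in> long_sums G N"
  obtains F c k d where "finite F" "F \<subseteq> I" "\<forall>i. i \<notin> F \<longrightarrow> c i = (0::nat)" "d \<in> dyadics"
    "s = real k * \<alpha> + d + (\<Sum>i\<in>F. real (c i) * gen i)" "d = 0 \<longrightarrow> N \<le> k + (\<Sum>i\<in>F. c i)"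
proof -
  from assms obtain ss where ss: "s = sum_list ss" "N \<le> length ss" "set ss \<subseteq> G"
    unfolding long_sums_def by blast
  have "\<exists>F c k d. finite F \<and> F \<subseteq> I \<and> (\<forall>i. i \<notin> F \<longrightarrow> c i = (0::nat)) \<and> d \<in> dyadics \<and>
    sum_list ss = real k * \<alpha> + d + (\<Sum>i\<in>F. real (c i) * gen i) \<and>
    (d = 0 \<longrightarrow> length ss \<le> k + (\<Sum>i\<in>F. c i))"
    using ss(3)
  proof (induction ss)
    case Nil
    show ?case
      by (intro exI[of _ "{}"] exI[of _ "\<lambda>_. 0"] exI[of _ 0]) (auto simp: zero_in_dyadics)
  next
    case (Cons x ss)
    then obtain F c k d where IH: "finite F" "F \<subseteq> I" "\<And>i. i \<notin> F \<Longrightarrow> c i = 0" "d \<in> dyadics"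
      "sum_list ss = real k * \<alpha> + d + (\<Sum>i\<in>F. real (c i) * gen i)"
      "d = 0 \<longrightarrow> length ss \<le> k + (\<Sum>i\<in>F. c i)"
      by auto
    from Cons.prems consider "x = \<alpha>" | n :: int where "x = 1 / 2 powi n" | i where "i \<in> I" "x = gen i"
      unfolding G_def by auto
    then show ?case
    proof cases
      case 1
      then show ?thesis using IH
        by (intro exI[of _ F] exI[of _ c] exI[of _ "Suc k"] exI[of _ d]) (auto simp: algebra_simps)
    next
      case 2
      \<comment> \<open>As \<open>x + d\<close> is positive, the claim on the length becomes
        vacuous.\<close>
      then have "x \<in> dyadics" "0 < x" using two_powi_in_dyadics by auto
      then show ?thesis using IH dyadics_nonneg[OF IH(4)]
        by (intro exI[of _ F] exI[of _ c] exI[of _ k] exI[of _ "x + d"])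
          (auto simp: algebra_simps intro: dyadics_add)
    next
      case 3
      have "(\<Sum>j\<in>insert i F. real ((c(i := Suc (c i))) j) * gen j) = gen i + (\<Sum>j\<in>F. real (c j) * gen j)"
        using sum_insert_Suc[OF IH(1), of c i gen] IH(3) by simp
      moreover have "(\<Sum>j\<in>insert i F. (c(i := Suc (c i))) j) = Suc (\<Sum>j\<in>F. c j)"
        using sum_insert_Suc[OF IH(1), of c i "\<lambda>_. 1 :: nat"] IH(3) by simp
      ultimately show ?thesis using IH 3
        by (intro exI[of _ "insert i F"] exI[of _ "c(i := Suc (c i))"] exI[of _ k] exI[of _ d])
          (simp del: fun_upd_apply, simp)
    qed
  qed
  then show ?thesis using that ss(1,2) by (elim exE conjE) (meson order_trans)
qed

lemma \<alpha>_in_long_sums: "\<alpha> \<in> long_sums G 0" and gen_in_long_sums: "i \<in> I \<Longrightarrow> gen i \<in> long_sums G 0"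
  using generator_in_long_sums[of _ G] long_sums_antimono[of 0 1 G] by (auto simp: G_def)

lemma dyadics_subset: "dyadics \<subseteq> long_sums G 0"
proof
  fix d assume "d \<in> dyadics"
  then obtain a n where an: "0 \<le> d" "d = of_int a / 2 ^ n"
    unfolding dyadics_def by blast
  then have "0 \<le> a" by (simp add: pos_le_divide_eq)
  have "1 / 2 powi int n \<in> G" unfolding G_def by blast
  then have "1 / 2 powi int n \<in> long_sums G 0"
    using generator_in_long_sums long_sums_antimono[of 0 1 G] by auto
  from long_sums_nat_mult[OF this, of "nat a"] show "d \<in> long_sums G 0"
    using an \<open>0 \<le> a\<close> by simp
qed

text \<open>Such an exponent has only one representation, with \<open>k\<close> summands
  \<open>\<alpha>\<close> and \<open>r i\<close> summands \<open>gen i\<close>. Comparing the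
  coefficients of \<open>\<alpha>\<close> in two representations gives \<open>r i \<le> c i\<close>
  by divisibility; comparing the rational parts then leaves no room for \<open>d\<close> or for any
  excess of \<open>c i\<close>.\<close>

lemma reduced_bounded_length:
  assumes F: "finite F" "F \<subseteq> I" and r: "\<And>i. i \<in> F \<Longrightarrow> r i < p i"
  shows "real k * \<alpha> + (\<Sum>i\<in>F. real (r i) * gen i) \<in> bounded_length G"
proof -
  let ?s = "real k * \<alpha> + (\<Sum>i\<in>F. real (r i) * gen i)"
  have "real (r i) * gen i \<in> long_sums G 0" if "i \<in> F" for i
    using F that by (intro long_sums_nat_mult gen_in_long_sums) auto
  then have "?s \<in> long_sums G 0"
    using long_sums_0_add[OF long_sums_nat_mult[OF \<alpha>_in_long_sums, of k]
      long_sums_sum[of F "\<lambda>i. real (r i) * gen i"]] by blast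
  \<comment> \<open>One more than the length of the only representation.\<close>
  moreover have "?s \<notin> long_sums G (Suc (k + (\<Sum>i\<in>F. r i)))"
  proof
    assume "?s \<in> long_sums G (Suc (k + (\<Sum>i\<in>F. r i)))"
    then obtain F' c k' d where rep: "finite F'" "F' \<subseteq> I" "\<forall>i. i \<notin> F' \<longrightarrow> c i = (0::nat)"
      "d \<in> dyadics" "?s = real k' * \<alpha> + d + (\<Sum>i\<in>F'. real (c i) * gen i)"
      "d = 0 \<longrightarrow> Suc (k + (\<Sum>i\<in>F. r i)) \<le> k' + (\<Sum>i\<in>F'. c i)"
      by (rule long_sums_rep)
    \<comment> \<open>Both representations are extended by zero coefficients to a common index
      set.\<close>
    define H where "H = F \<union> F'"
    define r' where "r' i = (if i \<in> F then r i else 0)" for i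
    have H: "finite H" "H \<subseteq> I" using F rep by (auto simp: H_def)
    have r': "r' i < p i" if "i \<in> H" for i
      using r p_pos[of i] H that by (auto simp: r'_def)
    have F_H: "(\<Sum>i\<in>F. real (r i) * gen i) = (\<Sum>i\<in>H. real (r' i) * gen i)"
      "(\<Sum>i\<in>F. r i) = (\<Sum>i\<in>H. r' i)"
      using F H by (auto intro!: sum.mono_neutral_cong_left simp: H_def r'_def)
    have F'_H: "(\<Sum>i\<in>F'. real (c i) * gen i) = (\<Sum>i\<in>H. real (c i) * gen i)"
      "(\<Sum>i\<in>F'. c i) = (\<Sum>i\<in>H. c i)"
      using rep(1,3) H by (auto intro!: sum.mono_neutral_cong_left simp: H_def)
    have expand: "(\<Sum>i\<in>H. real (t i) * gen i)
        = (\<Sum>i\<in>H. real (t i) / real (p i)) * \<alpha> + (\<Sum>i\<in>H. real (t i) * q i / real (p i))"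
      for t :: "'i \<Rightarrow> nat"
      unfolding sum_distrib_right sum.distrib[symmetric]
      by (intro sum.cong) (auto simp: gen_def algebra_simps divide_inverse)
    have q_rat: "(\<Sum>i\<in>H. real (t i) * q i / real (p i)) \<in> \<rat>" for t :: "'i \<Rightarrow> nat"
      using H q_dyadic dyadics_rational by (intro Rats_sum Rats_divide Rats_mult) auto
    have p_rat: "(\<Sum>i\<in>H. real (t i) / real (p i)) \<in> \<rat>" for t :: "'i \<Rightarrow> nat"
      by (intro Rats_sum Rats_divide) auto
    have eq: "(real k + (\<Sum>i\<in>H. real (r' i) / real (p i))) * \<alpha> + (\<Sum>i\<in>H. real (r' i) * q i / real (p i))
      = (real k' + (\<Sum>i\<in>H. real (c i) / real (p i))) * \<alpha> + (d + (\<Sum>i\<in>H. real (c i) * q i / real (p i)))"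
      using rep(5) unfolding F_H F'_H expand by (simp add: algebra_simps)
    note coeff = irrational_coeff[OF eq _ _ _ _ \<alpha>_irrational]
    have coeff_\<alpha>: "real k + (\<Sum>i\<in>H. real (r' i) / real (p i)) = real k' + (\<Sum>i\<in>H. real (c i) / real (p i))"
      and coeff_1: "(\<Sum>i\<in>H. real (r' i) * q i / real (p i)) = d + (\<Sum>i\<in>H. real (c i) * q i / real (p i))"
      using coeff p_rat q_rat dyadics_rational[OF rep(4)] by auto
    have "(\<Sum>i\<in>H. real_of_int (int (c i) - int (r' i)) / real (p i)) = real_of_int (int k - int k')"
      using coeff_\<alpha> by (simp add: diff_divide_distrib sum_subtractf)
    note dvd = prime_dvd_numerator[OF H(1) inj_on_subset[OF p_inj H(2)] p_prime[OF subsetD[OF H(2)]] this]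
    \<comment> \<open>\<open>p i\<close> divides the difference, and a positive
      \<open>r' i - c i\<close> would be smaller than \<open>p i\<close>.\<close>
    have le: "r' i \<le> c i" if "i \<in> H" for i
    proof (rule ccontr)
      assume "\<not> r' i \<le> c i"
      then have "int (p i) dvd int (r' i) - int (c i)" "0 < int (r' i) - int (c i)"
        using dvd[OF _ that] by (auto simp: dvd_diff_commute)
      then have "int (p i) \<le> int (r' i) - int (c i)" by (rule zdvd_imp_le)
      then show False using r'[OF that] by simp
    qed
    have pos: "0 \<le> (real (c i) - real (r' i)) * q i / real (p i)" if "i \<in> H" for i
      using le[OF that] H that q_pos[of i] by auto
    \<comment> \<open>A sum of nonnegative terms that vanishes, so \<open>d\<close> and each
      difference vanish.\<close>
    have sum0: "d + (\<Sum>i\<in>H. (real (c i) - real (r' i)) * q i / real (p i)) = 0"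
      using coeff_1 by (simp add: left_diff_distrib diff_divide_distrib sum_subtractf)
    then have d0: "d = 0" and "(\<Sum>i\<in>H. (real (c i) - real (r' i)) * q i / real (p i)) = 0"
      using dyadics_nonneg[OF rep(4)] sum_nonneg[of H, OF pos] by (auto simp: add_nonneg_eq_0_iff)
    then have "(real (c i) - real (r' i)) * q i / real (p i) = 0" if "i \<in> H" for i
      using sum_nonneg_eq_0_iff[OF H(1) pos] that by auto
    then have c: "c i = r' i" if "i \<in> H" for i
      using q_pos[of i] p_pos[of i] that H by fastforce
    then have "k = k'" using coeff_\<alpha> by simp
    with rep(6) d0 c show False by (simp add: F_H F'_H)
  qed
  ultimately show ?thesis unfolding bounded_length_def by blast
qed

text \<open>Division of \<open>c i\<close> by \<open>p i\<close> leaves an admissible digit, while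
  each carried block \<open>p i * gen i = \<alpha> + q i\<close> contributes one
  \<open>\<alpha>\<close> and one dyadic number.\<close>

lemma split_dyadic_part:
  assumes "s \<in> long_sums G 0"
  shows "\<exists>d\<in>dyadics. s - d \<in> bounded_length G"
proof -
  obtain F c k d where rep: "finite F" "F \<subseteq> I" "d \<in> dyadics"
      "s = real k * \<alpha> + d + (\<Sum>i\<in>F. real (c i) * gen i)"
    using long_sums_rep[OF assms] by metis
  \<comment> \<open>The original dyadic part together with all carried \<open>q i\<close>.\<close>
  define e where "e = d + (\<Sum>i\<in>F. real (c i div p i) * q i)"
  have "real (c i) * gen i = real (c i mod p i) * gen i + (real (c i div p i) * \<alpha> + real (c i div p i) * q i)"
    if "i \<in> F" for i
  proof -
    have "real (c i) = real (c i mod p i) + real (c i div p i) * real (p i)"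
      by (metis add.commute div_mult_mod_eq of_nat_add of_nat_mult)
    moreover have "real (c i div p i) * real (p i) * gen i = real (c i div p i) * (\<alpha> + q i)"
      using gen_mult[of i] rep(2) that by (auto simp: mult.assoc)
    ultimately show ?thesis by (simp add: algebra_simps)
  qed
  then have "(\<Sum>i\<in>F. real (c i) * gen i) = (\<Sum>i\<in>F. real (c i mod p i) * gen i) +
      ((\<Sum>i\<in>F. real (c i div p i)) * \<alpha> + (\<Sum>i\<in>F. real (c i div p i) * q i))"
    by (simp add: sum.distrib sum_distrib_right)
  then have "s - e = real (k + (\<Sum>i\<in>F. c i div p i)) * \<alpha> + (\<Sum>i\<in>F. real (c i mod p i) * gen i)"
    by (simp add: rep(4) e_def algebra_simps)
  moreover have "\<dots> \<in> bounded_length G"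
    using rep(1,2) p_pos by (intro reduced_bounded_length) auto
  moreover have "e \<in> dyadics"
    unfolding e_def using rep q_dyadic by (auto intro!: dyadics_add dyadics_sum dyadics_nat_mult)
  ultimately show ?thesis by metis
qed

text \<open>A non-integral \<open>d\<close> is some \<open>q i\<close>, and
  \<open>\<alpha> + q i\<close> is the sum of \<open>p i\<close> copies of
  \<open>gen i\<close>.\<close>

lemma \<alpha>_add_dyadic:
  assumes "d \<in> dyadics" "d = 0 \<or> d \<notin> \<int>"
  shows "\<exists>ss. set ss \<subseteq> bounded_length G \<and> \<alpha> + d = sum_list ss"
proof (cases "d = 0")
  case True
  have "\<alpha> \<in> bounded_length G" using reduced_bounded_length[of "{}" _ 1] by simp
  then show ?thesis using True by (intro exI[of _ "[\<alpha>]"]) simp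
next
  case False
  then obtain i where i: "i \<in> I" "d = q i" using assms q_surj by blast
  \<comment> \<open>The digit 1 is reduced because \<open>1 < p i\<close>.\<close>
  have "gen i \<in> bounded_length G"
    using reduced_bounded_length[of "{i}" "\<lambda>_. 1" 0] i p_prime[of i] prime_gt_1_nat by simp
  then show ?thesis using i
    by (intro exI[of _ "replicate (p i) (gen i)"]) (auto simp: sum_list_replicate gen_mult)
qed

text \<open>Each of the two parts given by \<open>dyadic_split\<close> takes one
  \<open>\<alpha>\<close>.\<close>

lemma two_\<alpha>_add_dyadic:
  assumes "d \<in> dyadics"
  shows "\<exists>ss. set ss \<subseteq> bounded_length G \<and> 2 * \<alpha> + d = sum_list ss"
proof -
  obtain d1 d2 where d: "d = d1 + d2" "d1 \<in> dyadics" "d2 \<in> dyadics"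
    "d1 = 0 \<or> d1 \<notin> \<int>" "d2 = 0 \<or> d2 \<notin> \<int>"
    using dyadic_split[OF assms] .
  then obtain ss ts where "set ss \<subseteq> bounded_length G" "\<alpha> + d1 = sum_list ss"
    "set ts \<subseteq> bounded_length G" "\<alpha> + d2 = sum_list ts"
    using \<alpha>_add_dyadic[of d1] \<alpha>_add_dyadic[of d2] by blast
  with d(1) show ?thesis by (intro exI[of _ "ss @ ts"]) (auto simp flip: \<open>\<alpha> + d1 = _\<close> \<open>\<alpha> + d2 = _\<close>)
qed

lemma semi_atomic_localized_monoid_algebra:
  fixes A :: "(real \<Rightarrow>\<^sub>0 'k::field) ring"
  defines "A \<equiv> monoid_algebra (nonempty_sums G \<union> {0})"
  shows "semi_atomic (localization_at A (Idl\<^bsub>A\<^esub> (monomial ` nonempty_sums G)))"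
proof -
  interpret positive_generators G "TYPE('k)"
    by unfold_locales (auto simp: G_def \<alpha>_pos gen_pos)
  have "2 * \<alpha> \<in> long_sums G 0"
    using long_sums_0_add[OF \<alpha>_in_long_sums \<alpha>_in_long_sums] by simp
  then show ?thesis
    unfolding A_def localization_eq
    using semi_atomic_R[OF dyadics_diff dyadics_subset split_dyadic_part _ two_\<alpha>_add_dyadic] by blast
qed

end

section \<open>The theorem for generators indexed by pairs\<close>

theorem corollary19:
  fixes p :: "nat \<times> nat \<Rightarrow> nat"
    and I :: "(nat \<times> nat) set"
    and \<alpha> :: real
    and S :: "real set"
    and A :: "(real \<Rightarrow>\<^sub>0 bit) ring"
    and X :: "(real \<Rightarrow>\<^sub>0 bit) set"
    and D :: "(real \<Rightarrow>\<^sub>0 bit) fract ring"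
  assumes "I = {(n, m). 0 < n \<and> 0 < m \<and> odd m}"
    and "inj_on p I"
    and "p ` I \<subseteq> {q. Factorial_Ring.prime q \<and> odd q}"
    and "0 < \<alpha>"
    and "\<alpha> \<notin> \<rat>"
    and "S = nonempty_sums
          ({\<alpha>} \<union> {1 / 2 powi n | n :: int. True}
             \<union> {inverse (real (p (n, m))) * (\<alpha> + real m / 2 ^ n) | n m. (n, m) \<in> I})"
    and "A = monoid_algebra (S \<union> {0})"
    and "X = monomial ` S"
    and "D = localization_at A (Idl\<^bsub>A\<^esub> X)"
  shows "semi_atomic D"
proof -
  define q where "q = (\<lambda>(n, m). real m / 2 ^ n :: real)"
  interpret dyadic_generators p q I \<alpha>
  proof
    show "q i \<in> dyadics" for i
      using dyadicsI[of "int (snd i)" "fst i"] by (simp add: q_def case_prod_beta)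
    show "\<exists>i\<in>I. d = q i" if "d \<in> dyadics" "d \<notin> \<int>" for d
      using nonint_dyadic[OF that] by (auto simp: assms(1) q_def)
  qed (use assms(1-5) in \<open>auto simp: q_def\<close>)
  have "gen ` I = {inverse (real (p (n, m))) * (\<alpha> + real m / 2 ^ n) | n m. (n, m) \<in> I}"
  proof -
    have "gen (n, m) = inverse (real (p (n, m))) * (\<alpha> + real m / 2 ^ n)" for n m
      unfolding gen_def by (simp add: q_def)
    moreover have "gen ` I = {gen (n, m) | n m. (n, m) \<in> I}" by auto
    ultimately show ?thesis by simp
  qed
  then have "S = nonempty_sums G" using assms(6) by (simp add: G_def)
  then show ?thesis
    using semi_atomic_localized_monoid_algebra assms(7-9) by simp
qed

end
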